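(* Let $0<|q|<1$, let $a,b$ be complex parameters, and let $$B_q(t)={}_2\phi_1(a,b;0;q,-t)=\sum_{n=0}^\infty\frac{(a;q)_n(b;q)_n}{(q;q)_n}(-t)^n,\qquad |t|<1,$$ which is the $q$-Borel transform of the formal series ${}_2\phi_0(a,b;-;q,z)$. By Heine's second transformation, $$B_q(t)=\frac{(-bt;q)_\infty}{(-t;q)_\infty}\,{}_1\phi_1(b;-bt;q,-at).$$ Hence $B_q(t)$ has simple poles at $t=-q^{-j}$, $j=0,1,2,\ldots$, with local behaviour $$B_q(t)\approx\frac{d_j(a,b)}{1+tq^j},\qquad j=0,1,2,\ldots,$$ where $d_{-1}(a,b)=0$, $d_0(a,b)=\dfrac{(a;q)_\infty(b;q)_\infty}{(q;q)_\infty}$, and $$(1-q^{-j})\,d_j(a,b)=\bigl(1-(a+b)q^{-j}\bigr)d_{j-1}(a,b)+ab\,q^{-j}d_{j-2}(a,b),\qquad j=1,2,3,\ldots.$$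
   Context: Notation: $(x;q)_\infty=\prod_{n=0}^\infty(1-xq^n)$ and $(x;q)_n=(1-x)(1-xq)\cdots(1-xq^{n-1})$, with $(x;q)_0=1$. The formal series is ${}_2\phi_0(a,b;-;q,z)=\sum_{n=0}^\infty\frac{(a;q)_n(b;q)_n}{(q;q)_n}q^{-\frac12n(n-1)}(-z)^n$. The $q$-Borel transform of a formal series $\sum_na_nz^n$ is $\sum_na_nq^{\frac12n(n-1)}t^n$. The function ${}_1\phi_1$ is ${}_1\phi_1(\alpha;\beta;q,x)=\sum_{n=0}^\infty\frac{(\alpha;q)_n}{(\beta;q)_n(q;q)_n}(-1)^nq^{\frac12n(n-1)}x^n$. The local behaviour refers to $t$ near $-q^{-j}$, for the analytic continuation of $B_q$.
   Formalization: The simple pole at t=-q^{-j} is asserted exactly when d_j(a,b)≠0 (for a=1, B_q is constant and has no poles); if d_j=0 the polar part vanishes. Heine's formula is stated off the poles where -bt·q^k≠1 for all k, so that the 1φ1 is defined. *)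

theory Defs
  imports "HOL-Complex_Analysis.Complex_Analysis"
begin

definition qpoch :: "complex \<Rightarrow> complex \<Rightarrow> nat \<Rightarrow> complex" where
  "qpoch x q n = (\<Prod>k<n. 1 - x * q ^ k)"

definition qpoch_inf :: "complex \<Rightarrow> complex \<Rightarrow> complex" where
  "qpoch_inf x q = (\<Prod>k. 1 - x * q ^ k)"

definition phi21 :: "complex \<Rightarrow> complex \<Rightarrow> complex \<Rightarrow> complex \<Rightarrow> complex \<Rightarrow> complex" where
  "phi21 a b c q z = (\<Sum>n. qpoch a q n * qpoch b q n / (qpoch c q n * qpoch q q n) * z ^ n)"

text \<open>Meaningful only if \<open>\<beta> q\<^sup>k \<noteq> 1\<close> for all \<open>k\<close>; otherwise some denominators vanish.\<close>
definition phi11 :: "complex \<Rightarrow> complex \<Rightarrow> complex \<Rightarrow> complex \<Rightarrow> complex" where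
  "phi11 \<alpha> \<beta> q x =
     (\<Sum>n. qpoch \<alpha> q n / (qpoch \<beta> q n * qpoch q q n) * (-1) ^ n * q ^ (n * (n - 1) div 2) * x ^ n)"

text \<open>The series \<open>2\<phi>0\<close> diverges in general, hence it is a formal power series in \<open>z\<close>;
  the sign of \<open>(-z)\<^sup>n\<close> is part of the coefficient.\<close>
definition phi20 :: "complex \<Rightarrow> complex \<Rightarrow> complex \<Rightarrow> complex fps" where
  "phi20 a b q = Abs_fps (\<lambda>n. qpoch a q n * qpoch b q n / qpoch q q n
                               * q powi (- int (n * (n - 1) div 2)) * (-1) ^ n)"

definition q_borel :: "complex \<Rightarrow> complex fps \<Rightarrow> complex fps" where
  "q_borel q f = Abs_fps (\<lambda>n. fps_nth f n * q ^ (n * (n - 1) div 2))"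

definition q_lattice :: "complex \<Rightarrow> complex set" where
  "q_lattice q = {- (q powi (- int j)) | j :: nat. True}"

text \<open>\<open>B\<close> is the analytic continuation of the sum of \<open>2\<phi>1(a,b;0;q,-t)\<close>, \<open>|t| < 1\<close>, to the
  complement of \<open>q_lattice q\<close>. That complement is connected, so \<open>B\<close> is unique there; values
  of \<open>B\<close> on \<open>q_lattice q\<close> are arbitrary.\<close>
definition continues_phi21 :: "complex \<Rightarrow> complex \<Rightarrow> complex \<Rightarrow> (complex \<Rightarrow> complex) \<Rightarrow> bool" where
  "continues_phi21 q a b B \<longleftrightarrow>
     B holomorphic_on (- q_lattice q) \<and> (\<forall>t. norm t < 1 \<longrightarrow> B t = phi21 a b 0 q (- t))"

end

theory Submission
  imports Defs
begin

text \<open>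
  Write \<open>z = -t\<close>. The proof starts from the right-hand side of Heine's formula. Multiplying out
  \<open>(bz;q)\<^sub>\<infinity> = (bz;q)\<^sub>k (bq\<^sup>kz;q)\<^sub>\<infinity>\<close> turns the numerator into
  \[F(z) = \sum_k \frac{(b;q)_k}{(q;q)_k} (-a)^k q^{k(k-1)/2} z^k (bq^kz;q)_\infty ,\]
  which makes sense for every \<open>z\<close>, including the points where the parameter \<open>bz\<close> of the
  \<open>1\<phi>1\<close> is forbidden, and is an entire function (\<open>heine_num\<close>). The function
  \<open>G(z) = F(z) / (z;q)\<^sub>\<infinity>\<close> (\<open>heine_cont\<close>) is therefore holomorphic off the zeros \<open>q\<^sup>-\<^sup>j\<close> of
  \<open>(z;q)\<^sub>\<infinity>\<close>, and it is the continuation that is wanted.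
  
  Everything rests on the single functional equation
  \[F(z) = (1-(a+b)z) F(qz) + abz (1-qz) F(q^2z)\]
  (\<open>heine_num_qdiff\<close>), which is checked term by term. It has three consequences.
  
  \<^item> It says that \<open>(1-z) G(z) = (1-(a+b)z) G(qz) + abz G(q\<^sup>2z)\<close>. Comparing coefficients at \<open>0\<close> gives
    the recurrence \<open>(1-q\<^sup>n\<^sup>+\<^sup>1) e\<^sub>n\<^sub>+\<^sub>1 = (1-aq\<^sup>n)(1-bq\<^sup>n) e\<^sub>n\<close>, so \<open>G\<close> is the sum of the \<open>2\<phi>1\<close> on
    the unit disc (\<open>heine_cont_sums\<close>). Existence of the continuation and Heine's formula follow
    together; any other continuation agrees with \<open>G\<close> by the identity theorem.
  
  \<^item> Since \<open>(z;q)\<^sub>\<infinity>\<close> has a simple zero at \<open>q\<^sup>-\<^sup>j\<close>, the coefficient of the principal part is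
    \<open>d\<^sub>j = F(q\<^sup>-\<^sup>j) / ((q\<^sup>-\<^sup>j;q)\<^sub>j (q;q)\<^sub>\<infinity>)\<close>, and the functional equation at \<open>z = q\<^sup>-\<^sup>j\<close> is the
    recurrence for \<open>d\<^sub>j\<close> (\<open>heine_res_Suc\<close>).
  
  \<^item> For \<open>b = 0\<close> it reads \<open>F(z) = (1-az) F(qz)\<close>; iterating it from \<open>z = 1\<close> gives Euler's identity,
    hence \<open>F(1) = (a;q)\<^sub>\<infinity> (b;q)\<^sub>\<infinity>\<close> (\<open>heine_num_1\<close>) and the value of \<open>d\<^sub>0\<close>.
\<close>

section \<open>The finite and the infinite \<open>q\<close>-Pochhammer symbol\<close>

lemma qpoch_0 [simp]: "qpoch x q 0 = 1"
  by (simp add: qpoch_def)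

lemma qpoch_Suc: "qpoch x q (Suc n) = qpoch x q n * (1 - x * q ^ n)"
  by (simp add: qpoch_def)

lemma qpoch_head: "qpoch x q (Suc n) = (1 - x) * qpoch (q * x) q n"
  by (simp add: qpoch_def prod.lessThan_Suc_shift mult_ac del: prod.lessThan_Suc)

lemma qpoch_zero [simp]: "qpoch 0 q n = 1"
  by (simp add: qpoch_def)

lemma qpoch_inf_zero [simp]: "qpoch_inf 0 q = 1"
  by (simp add: qpoch_inf_def)

lemma triangle_exponent_Suc: "Suc k * (Suc k - 1) div 2 = k * (k - 1) div 2 + k"
  by (cases k) (auto simp: algebra_simps)

context
  fixes q :: complex
  assumes q_nonzero: "q \<noteq> 0" and q_less_1: "norm q < 1"
begin

lemma q_pow_Suc_neq_1: "q ^ Suc n \<noteq> 1"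
proof
  assume "q ^ Suc n = 1"
  hence "norm q ^ Suc n = 1" by (metis norm_one norm_power)
  moreover have "norm q ^ Suc n < 1"
    using q_nonzero q_less_1 by (intro power_Suc_less_one) auto
  ultimately show False by simp
qed

lemma qpoch_q_nonzero: "qpoch q q n \<noteq> 0"
  using q_pow_Suc_neq_1 by (auto simp: qpoch_def)

lemma convergent_prod_qpoch_inf: "convergent_prod (\<lambda>k. 1 - x * q ^ k)"
proof -
  have "summable (\<lambda>k. norm (1 - x * q ^ k - 1))"
    using q_less_1 by (auto simp: norm_mult norm_power intro!: summable_mult summable_geometric)
  thus ?thesis
    using abs_convergent_prod_conv_summable abs_convergent_prod_imp_convergent_prod by blast
qed

text \<open>
  At a zero of \<open>(x;q)\<^sub>\<infinity>\<close>, a sufficiently large \<open>n\<close> puts the vanishing factor into the finite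
  product; this is how zeros are detected and their order is controlled.
\<close>

lemma qpoch_inf_split: "qpoch_inf x q = qpoch x q n * qpoch_inf (x * q ^ n) q"
  using has_prod_ignore_initial_segment'[OF convergent_prod_qpoch_inf, of x n]
  by (simp add: has_prod_iff qpoch_inf_def qpoch_def power_add mult_ac)

lemma qpoch_inf_head: "qpoch_inf x q = (1 - x) * qpoch_inf (q * x) q"
  using qpoch_inf_split[of x 1] by (simp add: qpoch_def mult.commute)

lemma qpoch_inf_eq_0_iff: "qpoch_inf x q = 0 \<longleftrightarrow> (\<exists>k. x * q ^ k = 1)"
proof
  assume "qpoch_inf x q = 0"
  with prodinf_nonzero[OF convergent_prod_qpoch_inf, of x] show "\<exists>k. x * q ^ k = 1"
    by (auto simp: qpoch_inf_def)
next
  assume "\<exists>k. x * q ^ k = 1"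
  then obtain k where "x * q ^ k = 1" ..
  hence "qpoch x q (Suc k) = 0" by (simp add: qpoch_Suc)
  thus "qpoch_inf x q = 0" by (subst qpoch_inf_split[of _ "Suc k"]) simp
qed

text \<open>
  The partial products converge uniformly on each disc because \<open>\<Sum>\<bar>xq\<^sup>k\<bar>\<close> is dominated there by a
  geometric series.
\<close>

lemma holomorphic_qpoch_inf_aux: "(\<lambda>x. qpoch_inf x q) holomorphic_on UNIV"
proof (rule holomorphic_uniform_sequence)
  fix z :: complex
  have tri: "norm x \<le> norm z + 1" if "x \<in> cball z 1" for x :: complex
    using norm_triangle_ineq2[of x z] that by (simp add: dist_norm norm_minus_commute)
  define R where "R = norm z + 1"
  have "uniformly_convergent_on (cball 0 R) (\<lambda>N x::complex. \<Prod>k<N. 1 - x * q ^ k)"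
  proof (rule uniformly_convergent_on_prod')
    show "uniformly_convergent_on (cball 0 R) (\<lambda>N x. \<Sum>k<N. norm (1 - x * q ^ k - 1))"
    proof (rule Weierstrass_m_test')
      show "summable (\<lambda>k. R * norm q ^ k)"
        using q_less_1 by (intro summable_mult summable_geometric) auto
    qed (auto simp: norm_mult norm_power mult_right_mono)
  qed (auto intro!: continuous_intros)
  then obtain g where g: "uniform_limit (cball 0 R) (\<lambda>N x::complex. \<Prod>k<N. 1 - x * q ^ k) g sequentially"
    by (auto simp: uniformly_convergent_on_def)
  also have "?this \<longleftrightarrow> uniform_limit (cball 0 R) (\<lambda>N x::complex. \<Prod>k<N. 1 - x * q ^ k)
               (\<lambda>x. qpoch_inf x q) sequentially"
  proof (intro uniform_limit_cong)
    fix x :: complex assume "x \<in> cball 0 R"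
    have "(\<lambda>n. \<Prod>k<n. 1 - x * q ^ k) \<longlonglongrightarrow> g x"
      by (rule tendsto_uniform_limitI[OF g]) fact
    hence "(\<lambda>n. \<Prod>k<Suc n. 1 - x * q ^ k) \<longlonglongrightarrow> g x"
      by (rule LIMSEQ_Suc)
    moreover have "(\<lambda>n. \<Prod>k<Suc n. 1 - x * q ^ k) \<longlonglongrightarrow> qpoch_inf x q"
      using convergent_prod_LIMSEQ[OF convergent_prod_qpoch_inf[of x]]
      unfolding lessThan_Suc_atMost qpoch_inf_def .
    ultimately show "g x = qpoch_inf x q"
      using tendsto_unique by force
  qed auto
  finally have "uniform_limit (cball z 1) (\<lambda>N x::complex. \<Prod>k<N. 1 - x * q ^ k)
                  (\<lambda>x. qpoch_inf x q) sequentially"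
    by (rule uniform_limit_on_subset) (use tri in \<open>auto simp: R_def\<close>)
  thus "\<exists>d>0. cball z d \<subseteq> UNIV \<and> uniform_limit (cball z d) (\<lambda>N x::complex. \<Prod>k<N. 1 - x * q ^ k)
                  (\<lambda>x. qpoch_inf x q) sequentially"
    by (intro exI[of _ 1]) auto
qed (auto intro!: holomorphic_intros)

lemma holomorphic_qpoch_inf [holomorphic_intros]:
  assumes "f holomorphic_on A"
  shows "(\<lambda>x. qpoch_inf (f x) q) holomorphic_on A"
  using holomorphic_on_compose_gen[OF assms holomorphic_qpoch_inf_aux] by (simp add: o_def)

section \<open>The entire numerator of Heine's formula\<close>

definition heine_coeff :: "complex \<Rightarrow> complex \<Rightarrow> nat \<Rightarrow> complex" where
  "heine_coeff a b k = qpoch b q k / qpoch q q k * (- a) ^ k * q ^ (k * (k - 1) div 2)"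

definition heine_term :: "complex \<Rightarrow> complex \<Rightarrow> nat \<Rightarrow> complex \<Rightarrow> complex" where
  "heine_term a b k z = heine_coeff a b k * z ^ k * qpoch_inf (b * q ^ k * z) q"

text \<open>
  This is \<open>(bz;q)\<^sub>\<infinity> 1\<phi>1(b; bz; q, az)\<close> with the factor \<open>(bz;q)\<^sub>\<infinity>\<close> multiplied into the series,
  which cancels all denominators \<open>(bz;q)\<^sub>k\<close>; see \<open>heine_num_phi11\<close>.
\<close>

definition heine_num :: "complex \<Rightarrow> complex \<Rightarrow> complex \<Rightarrow> complex" where
  "heine_num a b z = (\<Sum>k. heine_term a b k z)"

lemma heine_coeff_Suc:
  "heine_coeff a b (Suc k) =
     heine_coeff a b k * (- a * q ^ k * (1 - b * q ^ k) / (1 - q ^ Suc k))"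
  unfolding heine_coeff_def qpoch_Suc triangle_exponent_Suc power_add by simp

text \<open>
  The ratio of successive coefficients tends to \<open>0\<close> like \<open>q\<^sup>k\<close>, so the radius of convergence is
  infinite.
\<close>

lemma summable_heine_coeff: "summable (\<lambda>k. norm (heine_coeff a b k) * R ^ k)" if "R \<ge> 0"
proof -
  define r where "r k = - a * q ^ k * (1 - b * q ^ k) / (1 - q ^ Suc k)" for k
  have coeff_Suc: "heine_coeff a b (Suc k) = heine_coeff a b k * r k" for k
    unfolding r_def by (rule heine_coeff_Suc)
  have "(\<lambda>k. q ^ k) \<longlonglongrightarrow> 0"
    using q_less_1 by (rule LIMSEQ_power_zero)
  hence "(\<lambda>k. norm (r k) * R) \<longlonglongrightarrow> norm (- a * 0 * (1 - b * 0) / (1 - q * 0)) * R"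
    unfolding r_def power_Suc
    by (intro tendsto_mult tendsto_norm tendsto_divide tendsto_diff tendsto_const) auto
  hence "eventually (\<lambda>k. norm (r k) * R < 1/2) sequentially"
    by (intro order_tendstoD) auto
  then obtain N where N: "\<And>k. k \<ge> N \<Longrightarrow> norm (r k) * R < 1/2"
    by (auto simp: eventually_sequentially)
  show ?thesis
  proof (rule summable_ratio_test)
    fix k assume "N \<le> k"
    hence "norm (r k) * R \<le> 1/2" using N by fastforce
    hence "(norm (r k) * R) * (norm (heine_coeff a b k) * R ^ k) \<le> 1/2 * (norm (heine_coeff a b k) * R ^ k)"
      by (rule mult_right_mono) (use that in auto)
    thus "norm (norm (heine_coeff a b (Suc k)) * R ^ Suc k) \<le> 1/2 * norm (norm (heine_coeff a b k) * R ^ k)"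
      using that by (simp add: coeff_Suc norm_mult mult_ac)
  qed auto
qed

lemma uniform_limit_heine_num:
  assumes "R \<ge> 0"
  shows "uniform_limit (cball 0 R) (\<lambda>N z. \<Sum>k<N. heine_term a b k z) (heine_num a b) sequentially"
proof -
  \<comment> \<open>All arguments \<open>bq\<^sup>kz\<close> lie in one compact disc, which bounds the infinite products
    uniformly in \<open>k\<close>.\<close>
  have "continuous_on (cball 0 (norm b * R)) (\<lambda>x. qpoch_inf x q)"
    by (intro holomorphic_on_imp_continuous_on holomorphic_intros)
  hence "bounded ((\<lambda>x. qpoch_inf x q) ` cball 0 (norm b * R))"
    by (intro compact_imp_bounded compact_continuous_image) auto
  then obtain M where M: "\<And>x. norm x \<le> norm b * R \<Longrightarrow> norm (qpoch_inf x q) \<le> M"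
    by (force simp: bounded_iff)
  show ?thesis
    unfolding heine_num_def
  proof (rule Weierstrass_m_test)
    show "summable (\<lambda>k. (norm (heine_coeff a b k) * R ^ k) * M)"
      by (intro summable_mult2 summable_heine_coeff assms)
    fix k :: nat and z :: complex
    assume z: "z \<in> cball 0 R"
    have "norm q ^ k \<le> 1" using q_less_1 by (intro power_le_one) auto
    hence "norm b * norm q ^ k * norm z \<le> norm b * 1 * R"
      using z assms by (intro mult_mono mult_nonneg_nonneg) auto
    hence "norm (qpoch_inf (b * q ^ k * z) q) \<le> M"
      by (intro M) (simp add: norm_mult norm_power)
    thus "norm (heine_term a b k z) \<le> (norm (heine_coeff a b k) * R ^ k) * M"
      unfolding heine_term_def norm_mult norm_power
      using z assms by (intro mult_mono power_mono mult_nonneg_nonneg) auto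
  qed
qed

lemma heine_term_sums: "(\<lambda>k. heine_term a b k z) sums heine_num a b z"
  unfolding sums_def using uniform_limit_heine_num[of "norm z" a b]
  by (rule tendsto_uniform_limitI) auto

lemma holomorphic_heine_num_aux: "heine_num a b holomorphic_on UNIV"
proof (rule holomorphic_uniform_sequence)
  fix z :: complex
  have tri: "norm x \<le> norm z + 1" if "x \<in> cball z 1" for x :: complex
    using norm_triangle_ineq2[of x z] that by (simp add: dist_norm norm_minus_commute)
  have "uniform_limit (cball z 1) (\<lambda>N z. \<Sum>k<N. heine_term a b k z) (heine_num a b) sequentially"
    by (rule uniform_limit_on_subset[OF uniform_limit_heine_num[of "norm z + 1"]])
       (use tri in auto)
  thus "\<exists>d>0. cball z d \<subseteq> UNIV \<and> uniform_limit (cball z d)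
          (\<lambda>N z. \<Sum>k<N. heine_term a b k z) (heine_num a b) sequentially"
    by (intro exI[of _ 1]) auto
qed (auto intro!: holomorphic_intros simp: heine_term_def)

lemma holomorphic_heine_num [holomorphic_intros]:
  assumes "f holomorphic_on A"
  shows "(\<lambda>x. heine_num a b (f x)) holomorphic_on A"
  using holomorphic_on_compose_gen[OF assms holomorphic_heine_num_aux] by (simp add: o_def)

lemma heine_num_0 [simp]: "heine_num a b 0 = 1"
proof -
  have "(\<lambda>k. heine_term a b k 0) sums (\<Sum>k\<in>{0}. heine_term a b k 0)"
    by (rule sums_finite) (auto simp: heine_term_def)
  hence "(\<lambda>k. heine_term a b k 0) sums 1"
    by (simp add: heine_term_def heine_coeff_def)
  with heine_term_sums show ?thesis using sums_unique2 by blast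
qed

text \<open>
  Compare the coefficients of \<open>a\<^sup>k\<close> on both sides, where \<open>F = \<Sum>a\<^sup>k f\<^sub>k\<close>: the claim is
  \<open>f\<^sub>k\<^sub>+\<^sub>1(z) - (1-bz) f\<^sub>k\<^sub>+\<^sub>1(qz) = -z f\<^sub>k(qz) + bz(1-qz) f\<^sub>k(q\<^sup>2z)\<close>. After division by the common factor
  \<open>(bq\<^sup>k\<^sup>+\<^sup>2z;q)\<^sub>\<infinity>\<close> this is a polynomial identity equivalent to the recurrence of the coefficients.
\<close>

lemma heine_num_qdiff:
  "heine_num a b z =
     (1 - (a + b) * z) * heine_num a b (q * z) + a * b * z * (1 - q * z) * heine_num a b (q ^ 2 * z)"
proof -
  define h where "h k = - a * z * heine_term a b k (q * z)
      + a * b * z * (1 - q * z) * heine_term a b k (q ^ 2 * z)" for k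
  define f where "f k = heine_term a b k z - (1 - b * z) * heine_term a b k (q * z)" for k
  have f_Suc: "f (Suc k) = h k" for k
  proof -
    define X where "X = qpoch_inf (b * q ^ (k + 2) * z) q"
    have 1: "qpoch_inf (b * q ^ (k + 1) * z) q = (1 - b * q ^ (k + 1) * z) * X"
      unfolding X_def by (subst qpoch_inf_head) (simp add: mult_ac)
    have D: "1 - q ^ Suc k \<noteq> 0" using q_pow_Suc_neq_1[of k] by simp
    have 2: "heine_term a b (Suc k) z =
               heine_coeff a b (Suc k) * z ^ Suc k * ((1 - b * q ^ (k + 1) * z) * X)"
      using 1 by (simp add: heine_term_def)
    have 3: "heine_term a b (Suc k) (q * z) = heine_coeff a b (Suc k) * q ^ Suc k * z ^ Suc k * X"
      by (simp add: heine_term_def X_def power_mult_distrib mult_ac)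
    have 4: "heine_term a b k (q * z) =
               heine_coeff a b k * q ^ k * z ^ k * ((1 - b * q ^ (k + 1) * z) * X)"
      using 1 by (simp add: heine_term_def power_mult_distrib mult_ac)
    have 5: "heine_term a b k (q ^ 2 * z) = heine_coeff a b k * q ^ k * q ^ k * z ^ k * X"
      by (simp add: heine_term_def X_def power_mult_distrib power2_eq_square mult_ac)
    have "f (Suc k) = heine_coeff a b (Suc k) * (1 - q ^ Suc k) * z ^ Suc k * X"
      unfolding f_def 2 3 by (simp add: algebra_simps)
    also have "heine_coeff a b (Suc k) * (1 - q ^ Suc k) =
                 heine_coeff a b k * (- a * q ^ k * (1 - b * q ^ k))"
      using D by (simp add: heine_coeff_Suc del: power_Suc)
    also have "\<dots> * z ^ Suc k * X = h k"
      unfolding h_def 4 5 by (simp add: algebra_simps)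
    finally show ?thesis .
  qed
  have f_0: "f 0 = 0"
    unfolding f_def heine_term_def using qpoch_inf_head[of "b * z"] by (simp add: mult_ac)
  have "f sums (heine_num a b z - (1 - b * z) * heine_num a b (q * z))"
    unfolding f_def by (intro sums_diff sums_mult heine_term_sums)
  hence "(\<lambda>k. f (Suc k)) sums (heine_num a b z - (1 - b * z) * heine_num a b (q * z))"
    using f_0 by (simp add: sums_Suc_iff)
  moreover have "h sums (- a * z * heine_num a b (q * z)
      + a * b * z * (1 - q * z) * heine_num a b (q ^ 2 * z))"
    unfolding h_def by (intro sums_add sums_mult heine_term_sums)
  ultimately have "heine_num a b z - (1 - b * z) * heine_num a b (q * z) = - a * z * heine_num a b (q * z)
      + a * b * z * (1 - q * z) * heine_num a b (q ^ 2 * z)"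
    unfolding f_Suc using sums_unique2 by blast
  thus ?thesis by (simp add: algebra_simps)
qed

lemma heine_num_phi11:
  assumes "\<And>k. b * z * q ^ k \<noteq> 1"
  shows "heine_num a b z = qpoch_inf (b * z) q * phi11 b (b * z) q (a * z)"
proof -
  let ?u = "\<lambda>n. qpoch b q n / (qpoch (b * z) q n * qpoch q q n) * (-1) ^ n
              * q ^ (n * (n - 1) div 2) * (a * z) ^ n"
  have nz: "qpoch_inf (b * z) q \<noteq> 0" using assms by (simp add: qpoch_inf_eq_0_iff)
  have *: "heine_term a b k z = qpoch_inf (b * z) q * ?u k" for k
  proof -
    have "qpoch (b * z) q k \<noteq> 0" using assms by (auto simp: qpoch_def)
    thus ?thesis
      using qpoch_inf_split[of "b * z" k]
      by (simp add: heine_term_def heine_coeff_def mult_ac power_mult_distrib power_minus[of a])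
  qed
  have "?u sums (heine_num a b z / qpoch_inf (b * z) q)"
    using sums_divide[OF heine_term_sums[of a b z], of "qpoch_inf (b * z) q"] nz by (simp add: *)
  hence "phi11 b (b * z) q (a * z) = heine_num a b z / qpoch_inf (b * z) q"
    unfolding phi11_def by (rule sums_unique[symmetric])
  thus ?thesis using nz by simp
qed

text \<open>
  At \<open>z = 1\<close> one has \<open>(b;q)\<^sub>k (bq\<^sup>k;q)\<^sub>\<infinity> = (b;q)\<^sub>\<infinity>\<close> in every term, so the value is \<open>(b;q)\<^sub>\<infinity>\<close> times
  the value for \<open>b = 0\<close>. The latter is Euler's series for \<open>(a;q)\<^sub>\<infinity>\<close>: iterate the first-order
  functional equation along \<open>1, q, q\<^sup>2, \<dots>\<close> and use continuity at \<open>0\<close>.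
\<close>

lemma heine_num_1: "heine_num a b 1 = qpoch_inf a q * qpoch_inf b q"
proof -
  have lim: "(\<lambda>n. q ^ n) \<longlonglongrightarrow> 0"
    using q_less_1 by (rule LIMSEQ_power_zero)
  have "continuous_on UNIV (\<lambda>z. heine_num a 0 z)" 
    by (intro holomorphic_on_imp_continuous_on holomorphic_intros)
  hence "(\<lambda>n. heine_num a 0 (q ^ n)) \<longlonglongrightarrow> heine_num a 0 0"
    by (rule continuous_on_tendsto_compose) (use lim in auto)
  moreover have "continuous_on UNIV (\<lambda>x. qpoch_inf x q)"
    by (intro holomorphic_on_imp_continuous_on holomorphic_intros)
  hence "(\<lambda>n. qpoch_inf (a * q ^ n) q) \<longlonglongrightarrow> qpoch_inf (a * 0) q"
    by (rule continuous_on_tendsto_compose) (use tendsto_mult_left[OF lim] in auto)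
  ultimately have 1: "(\<lambda>n. heine_num a 0 (q ^ n) * qpoch_inf a q) \<longlonglongrightarrow> 1 * qpoch_inf a q"
    and 2: "(\<lambda>n. heine_num a 0 1 * qpoch_inf (a * q ^ n) q) \<longlonglongrightarrow> heine_num a 0 1 * 1"
    by (simp_all only: tendsto_mult_right tendsto_mult_left heine_num_0 mult_zero_right qpoch_inf_zero)
  have "heine_num a 0 1 = qpoch a q n * heine_num a 0 (q ^ n)" for n
  proof (induction n)
    case (Suc n)
    thus ?case using heine_num_qdiff[of a 0 "q ^ n"] by (simp add: qpoch_Suc)
  qed auto
  hence "heine_num a 0 (q ^ n) * qpoch_inf a q = heine_num a 0 1 * qpoch_inf (a * q ^ n) q" for n
    using qpoch_inf_split[of a n] by (metis mult.assoc mult.commute)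
  with 1 2 have a: "heine_num a 0 1 = qpoch_inf a q"
    using LIMSEQ_unique by fastforce
  have "heine_term a b k 1 = qpoch_inf b q * heine_term a 0 k 1" for k
    using qpoch_inf_split[of b k] by (simp add: heine_term_def heine_coeff_def)
  hence "heine_num a b 1 = qpoch_inf b q * heine_num a 0 1"
    using heine_term_sums[of a b 1] sums_mult[OF heine_term_sums[of a 0 1], of "qpoch_inf b q"]
    by (simp add: sums_unique2)
  with a show ?thesis by simp
qed

section \<open>The continuation and its power series\<close>

definition heine_cont :: "complex \<Rightarrow> complex \<Rightarrow> complex \<Rightarrow> complex" where
  "heine_cont a b z = heine_num a b z / qpoch_inf z q"

lemma heine_cont_qdiff:
  assumes "qpoch_inf z q \<noteq> 0"
  shows "(1 - z) * heine_cont a b z =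
           (1 - (a + b) * z) * heine_cont a b (q * z) + a * b * z * heine_cont a b (q ^ 2 * z)"
proof -
  have 1: "qpoch_inf z q = (1 - z) * qpoch_inf (q * z) q"
    and 2: "qpoch_inf (q * z) q = (1 - q * z) * qpoch_inf (q ^ 2 * z) q"
    using qpoch_inf_head[of z] qpoch_inf_head[of "q * z"] by (simp_all add: power2_eq_square mult_ac)
  with assms have nz: "1 - z \<noteq> 0" "1 - q * z \<noteq> 0" "qpoch_inf (q ^ 2 * z) q \<noteq> 0"
    by auto
  define N where "N = heine_num a b z"
  define N1 where "N1 = heine_num a b (q * z)"
  define N2 where "N2 = heine_num a b (q ^ 2 * z)"
  have N: "N = (1 - (a + b) * z) * N1 + a * b * z * (1 - q * z) * N2"
    unfolding N_def N1_def N2_def by (rule heine_num_qdiff)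
  show ?thesis
    unfolding heine_cont_def 1 2 N_def[symmetric] N1_def[symmetric] N2_def[symmetric] N
    using nz by (simp add: divide_simps) 
qed

lemma qpoch_inf_nonzero_of_norm_less_1:
  assumes "norm z < 1"
  shows "qpoch_inf z q \<noteq> 0"
proof -
  have "z * q ^ k \<noteq> 1" for k
  proof -
    have "norm q ^ k \<le> 1" using q_less_1 by (intro power_le_one) auto
    hence "norm (z * q ^ k) \<le> norm z * 1"
      unfolding norm_mult norm_power by (intro mult_left_mono) auto
    thus ?thesis using assms by auto
  qed
  thus ?thesis by (simp add: qpoch_inf_eq_0_iff)
qed

text \<open>
  A solution of the \<open>q\<close>-difference equation that is holomorphic at \<open>0\<close> is determined by its value
  there, because \<open>1 - q\<^sup>n\<^sup>+\<^sup>1 \<noteq> 0\<close> allows solving for the coefficients one after the other. The resulting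
  series has radius of convergence at least \<open>1\<close> since the zeros of \<open>(z;q)\<^sub>\<infinity>\<close> lie outside the open
  unit disc.
\<close>

lemma heine_cont_sums:
  assumes "norm z < 1"
  shows "(\<lambda>n. qpoch a q n * qpoch b q n / qpoch q q n * z ^ n) sums heine_cont a b z"
proof -
  define G where "G = heine_cont a b"
  have holo: "G holomorphic_on ball 0 1"
    unfolding G_def heine_cont_def using qpoch_inf_nonzero_of_norm_less_1
    by (auto intro!: holomorphic_intros)
  define e where "e = fps_expansion G 0"
  have G: "G has_fps_expansion e"
    unfolding e_def using holo by (intro has_fps_expansion_fps_expansion[of "ball 0 1"]) auto
  have lin: "(\<lambda>z. G (c * z)) has_fps_expansion (fps_compose e (fps_const c * fps_X))" for c
    using has_fps_expansion_compose[OF G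
      has_fps_expansion_mult[OF has_fps_expansion_const[of c] has_fps_expansion_fps_X]]
    by (simp add: o_def)
  have L: "(\<lambda>z. (1 - z) * G z) has_fps_expansion (1 - fps_X) * e"
    by (intro fps_expansion_intros G)
  have R: "(\<lambda>z. (1 - (a + b) * z) * G (q * z) + a * b * z * G (q ^ 2 * z)) has_fps_expansion
      (1 - fps_const (a + b) * fps_X) * (fps_compose e (fps_const q * fps_X))
        + fps_const (a * b) * fps_X * (fps_compose e (fps_const (q ^ 2) * fps_X))" (is "_ has_fps_expansion ?r")
    by (intro fps_expansion_intros lin)
  have "eventually (\<lambda>z. (1 - z) * G z =
       (1 - (a + b) * z) * G (q * z) + a * b * z * G (q ^ 2 * z)) (nhds 0)"
  proof -
    have "eventually (\<lambda>z. z \<in> ball 0 1) (nhds (0 :: complex))"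
      by (intro eventually_nhds_in_open) auto
    thus ?thesis
      by eventually_elim (auto simp: G_def intro!: heine_cont_qdiff qpoch_inf_nonzero_of_norm_less_1)
  qed
  hence "(\<lambda>z. (1 - z) * G z) has_fps_expansion ?r"
    using R by (subst has_fps_expansion_cong[OF _ refl])
  with L have eq: "(1 - fps_X) * e = ?r"
    by (rule fps_expansion_unique_complex)
  have e_Suc: "(1 - q ^ Suc n) * fps_nth e (Suc n) = (1 - a * q ^ n) * (1 - b * q ^ n) * fps_nth e n" for n
    using arg_cong[OF eq[unfolded fps_compose_linear], of "\<lambda>f. fps_nth f (Suc n)"]
    by (simp add: algebra_simps power2_eq_square power_mult_distrib)
  have "fps_nth e n = qpoch a q n * qpoch b q n / qpoch q q n" for n
  proof (induction n)
    case 0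
    have "G 0 = 1" by (simp add: G_def heine_cont_def)
    thus ?case using has_fps_expansion_imp_0_eq_fps_nth_0[OF G] by simp
  next
    case (Suc n)
    have "1 - q ^ Suc n \<noteq> 0" using q_pow_Suc_neq_1[of n] by simp
    hence "fps_nth e (Suc n) = (1 - a * q ^ n) * (1 - b * q ^ n) * fps_nth e n / (1 - q ^ Suc n)"
      using e_Suc[of n] by (simp add: field_simps)
    thus ?case by (simp add: Suc qpoch_Suc mult_ac)
  qed
  moreover have "(\<lambda>n. fps_nth e n * z ^ n) sums G z"
    using holomorphic_power_series[OF holo, of z] assms by (simp add: e_def fps_expansion_def)
  ultimately show ?thesis by (simp add: G_def)
qed

lemma phi21_eq_heine_cont: "norm z < 1 \<Longrightarrow> phi21 a b 0 q z = heine_cont a b z"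
  unfolding phi21_def using heine_cont_sums[of z a b] by (simp add: sums_iff)

text \<open>
  Viewing the lattice as the zero set of an entire function makes it closed without any discussion of
  accumulation points.
\<close>

lemma q_lattice_iff: "t \<in> q_lattice q \<longleftrightarrow> qpoch_inf (- t) q = 0"
proof -
  have "t = - (q powi (- int k)) \<longleftrightarrow> - t * q ^ k = 1" for k
    using q_nonzero by (auto simp: power_int_minus field_simps minus_equation_iff)
  thus ?thesis unfolding qpoch_inf_eq_0_iff q_lattice_def by blast
qed

lemma open_compl_q_lattice: "open (- q_lattice q)"
proof -
  have "open ((\<lambda>t. qpoch_inf (- t) q) -` (- {0}))"
    by (intro open_vimage holomorphic_on_imp_continuous_on holomorphic_intros) auto
  also have "(\<lambda>t. qpoch_inf (- t) q) -` (- {0}) = - q_lattice q"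
    by (auto simp: q_lattice_iff)
  finally show ?thesis .
qed

lemma connected_compl_q_lattice: "connected (- q_lattice q)"
proof -
  have "q_lattice q = range (\<lambda>j::nat. - (q powi (- int j)))"
    by (auto simp: q_lattice_def)
  hence "countable (q_lattice q)" by simp
  thus ?thesis
    by (intro path_connected_imp_connected path_connected_complement_countable) auto
qed

lemma continues_phi21_heine_cont: "continues_phi21 q a b (\<lambda>t. heine_cont a b (- t))"
  unfolding continues_phi21_def heine_cont_def
  by (auto intro!: holomorphic_intros simp: q_lattice_iff phi21_eq_heine_cont heine_cont_def)

text \<open>
  The identity theorem applies because the complement of the lattice is open and, the lattice being
  countable, connected.
\<close>

lemma continues_phi21_unique:
  assumes "continues_phi21 q a b B" "t \<notin> q_lattice q"
  shows "B t = heine_cont a b (- t)"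
proof (rule analytic_continuation_open[where s = "ball 0 1" and s' = "- q_lattice q"
        and f = B and g = "\<lambda>t. heine_cont a b (- t)" and z = t])
  show "ball 0 1 \<subseteq> - q_lattice q"
    using qpoch_inf_nonzero_of_norm_less_1 by (auto simp: q_lattice_iff)
  show "B holomorphic_on - q_lattice q" "(\<lambda>t. heine_cont a b (- t)) holomorphic_on - q_lattice q"
    using assms continues_phi21_heine_cont by (auto simp: continues_phi21_def)
  show "B z = heine_cont a b (- z)" if "z \<in> ball 0 1" for z
    using that assms by (auto simp: continues_phi21_def phi21_eq_heine_cont)
qed (use assms open_compl_q_lattice connected_compl_q_lattice in auto)

section \<open>Principal parts at the lattice points\<close>

text \<open>
  The denominator is what remains of \<open>(z;q)\<^sub>\<infinity>\<close> at \<open>z = q\<^sup>-\<^sup>j\<close> when its vanishing factor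
  \<open>1 - zq\<^sup>j\<close> is removed, so this is the limit of \<open>(1 - zq\<^sup>j) G(z)\<close>.
\<close>

definition heine_res :: "complex \<Rightarrow> complex \<Rightarrow> nat \<Rightarrow> complex" where
  "heine_res a b j = heine_num a b (inverse q ^ j) / (qpoch (inverse q ^ j) q j * qpoch_inf q q)"

lemma inverse_q_pow_Suc_neq_1: "inverse q ^ Suc n \<noteq> 1"
  using q_pow_Suc_neq_1[of n] by (metis inverse_eq_1_iff power_inverse)

lemma qpoch_inverse_Suc:
  "qpoch (inverse q ^ Suc n) q (Suc n) = (1 - inverse q ^ Suc n) * qpoch (inverse q ^ n) q n"
proof -
  have "q * inverse q ^ Suc n = inverse q ^ n" using q_nonzero by simp
  thus ?thesis by (subst qpoch_head) (simp only:)
qed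

lemma qpoch_inverse_nonzero: "qpoch (inverse q ^ n) q n \<noteq> 0"
proof (induction n)
  case (Suc n)
  thus ?case unfolding qpoch_inverse_Suc using inverse_q_pow_Suc_neq_1[of n] by simp
qed auto

lemma qpoch_inf_q_nonzero: "qpoch_inf q q \<noteq> 0"
  using qpoch_inf_nonzero_of_norm_less_1 q_less_1 by blast

text \<open>
  The functional equation of the numerator at \<open>z = q\<^sup>-\<^sup>n\<^sup>-\<^sup>1\<close>, divided by the denominator of the
  \<open>n\<close>-th coefficient. The convention \<open>d\<^sub>-\<^sub>1 = 0\<close> is automatic: for \<open>n = 0\<close> the factor \<open>1 - qz\<close> vanishes.
\<close>

lemma heine_res_Suc:
  "(1 - inverse q ^ Suc n) * heine_res a b (Suc n) =
     (1 - (a + b) * inverse q ^ Suc n) * heine_res a b n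
     + a * b * inverse q ^ Suc n * (if n = 0 then 0 else heine_res a b (n - 1))"
proof -
  define w where "w = inverse q ^ Suc n"
  have qw: "q * w = inverse q ^ n" using q_nonzero by (simp add: w_def)
  have w1: "1 - w \<noteq> 0" using inverse_q_pow_Suc_neq_1[of n] by (simp add: w_def)
  define Q where "Q = qpoch (inverse q ^ n) q n * qpoch_inf q q"
  have Q: "Q \<noteq> 0" using qpoch_inverse_nonzero qpoch_inf_q_nonzero by (simp add: Q_def)
  have last: "(1 - q * w) * heine_num a b (q ^ 2 * w) / Q = (if n = 0 then 0 else heine_res a b (n - 1))"
  proof (cases n)
    case 0
    thus ?thesis using qw by simp
  next
    case (Suc m)
    have "q ^ 2 * w = inverse q ^ m" using qw Suc q_nonzero by (simp add: power2_eq_square mult.assoc)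
    moreover have "Q = (1 - q * w) * (qpoch (inverse q ^ m) q m * qpoch_inf q q)"
      using Suc qw by (simp add: Q_def qpoch_inverse_Suc del: power_Suc)
    ultimately show ?thesis using Q Suc by (simp add: heine_res_def)
  qed
  have "(1 - w) * heine_res a b (Suc n) = heine_num a b w / Q"
    using w1 by (simp add: heine_res_def Q_def w_def qpoch_inverse_Suc mult.assoc del: power_Suc)
  also have "\<dots> = (1 - (a + b) * w) * (heine_num a b (q * w) / Q)
                 + a * b * w * ((1 - q * w) * heine_num a b (q ^ 2 * w) / Q)"
    by (subst heine_num_qdiff) (simp add: add_divide_distrib)
  also have "heine_num a b (q * w) / Q = heine_res a b n"
    by (simp add: qw heine_res_def Q_def)
  finally show ?thesis unfolding last unfolding w_def .
qed

text \<open>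
  Removing the factor \<open>1 + tq\<^sup>j = q\<^sup>j(t - p)\<close> from \<open>(-t;q)\<^sub>\<infinity>\<close> leaves an entire function \<open>K\<close> with
  \<open>K(p) \<noteq> 0\<close>. On the open set \<open>S\<close> where \<open>K\<close> does not vanish, \<open>p\<close> is the only lattice point; this also
  shows that the lattice points are isolated.
\<close>

lemma heine_cont_local:
  fixes j :: nat
  defines "p \<equiv> - (inverse q ^ j)"
  obtains S H where "open S" "p \<in> S" "H holomorphic_on S" "H p = heine_res a b j"
    "\<And>t. t \<in> S \<Longrightarrow> t \<noteq> p \<Longrightarrow> t \<notin> q_lattice q \<and> heine_cont a b (- t) = H t / (q ^ j * (t - p))"
proof
  define K where "K t = qpoch (- t) q j * qpoch_inf (- t * q ^ Suc j) q" for t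
  define H where "H t = heine_num a b (- t) / K t" for t
  define S where "S = K -` (- {0})"
  have K: "K holomorphic_on UNIV"
    unfolding K_def qpoch_def by (intro holomorphic_intros)
  show "open S"
    unfolding S_def using K by (intro open_vimage holomorphic_on_imp_continuous_on) auto
  have "inverse q ^ j * q ^ Suc j = q"
    using q_nonzero by (simp add: field_simps)
  hence Kp: "K p = qpoch (inverse q ^ j) q j * qpoch_inf q q"
    by (simp add: K_def p_def del: power_Suc)
  thus "p \<in> S"
    using qpoch_inverse_nonzero qpoch_inf_q_nonzero by (simp add: S_def)
  show "H holomorphic_on S"
    unfolding H_def by (intro holomorphic_intros holomorphic_on_subset[OF K]) (auto simp: S_def)
  show "H p = heine_res a b j"
    by (simp add: H_def heine_res_def Kp) (simp add: p_def)
  fix t assume t: "t \<in> S" "t \<noteq> p"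
  have fac: "q ^ j * (t - p) = 1 - (- t) * q ^ j"
    using q_nonzero by (simp add: p_def field_simps)
  have "qpoch_inf (- t) q = qpoch (- t) q (Suc j) * qpoch_inf (- t * q ^ Suc j) q"
    by (rule qpoch_inf_split)
  also have "\<dots> = K t * (q ^ j * (t - p))"
    unfolding fac K_def qpoch_Suc by (simp only: mult_ac)
  finally have "qpoch_inf (- t) q = K t * (q ^ j * (t - p))" .
  thus "t \<notin> q_lattice q \<and> heine_cont a b (- t) = H t / (q ^ j * (t - p))"
    using t q_nonzero by (simp add: q_lattice_iff heine_cont_def H_def S_def)
qed

end

text \<open>
  The regular part of \<open>H(t) / (c(t - p))\<close> is the difference quotient of \<open>H\<close> at \<open>p\<close>, whose singularity
  is removable. The pole is genuine unless the numerator vanishes at \<open>p\<close>.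
\<close>

lemma simple_pole_quotient:
  fixes p c :: complex
  assumes S: "open S" "p \<in> S" and H: "H holomorphic_on S" and c: "c \<noteq> 0"
    and B: "\<And>t. t \<in> S \<Longrightarrow> t \<noteq> p \<Longrightarrow> B t = H t / (c * (t - p))"
  shows "\<exists>g. g analytic_on {p} \<and> (\<forall>\<^sub>F t in at p. B t = H p / (c * (t - p)) + g t)"
    and "is_pole B p \<longleftrightarrow> H p \<noteq> 0"
    and "H p \<noteq> 0 \<Longrightarrow> zorder B p = -1"
proof -
  define g where "g t = (if t = p then deriv H p else (H t - H p) / (t - p)) / c" for t
  have g: "g holomorphic_on S"
    unfolding g_def using S H c by (intro holomorphic_on_divide pole_lemma_open holomorphic_on_const) auto
  have inS: "\<forall>\<^sub>F t in at p. t \<in> S - {p}"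
    using S by (intro eventually_at_in_open) auto
  have "B t = H p / (c * (t - p)) + g t" if "t \<in> S" "t \<noteq> p" for t
  proof -
    have "g t = H t / (c * (t - p)) - H p / (c * (t - p))"
      using that by (simp add: g_def diff_divide_distrib mult.commute[of c])
    thus ?thesis using B[OF that] by simp
  qed
  hence ev: "\<forall>\<^sub>F t in at p. B t = H p / (c * (t - p)) + g t"
    using eventually_mono[OF inS, of "\<lambda>t. B t = H p / (c * (t - p)) + g t"] by blast
  thus "\<exists>g. g analytic_on {p} \<and> (\<forall>\<^sub>F t in at p. B t = H p / (c * (t - p)) + g t)"
    using g S analytic_at by blast
  have evB: "\<forall>\<^sub>F t in at p. H t / (c * (t - p)) = B t"
    using inS by eventually_elim (use B in auto)
  show "is_pole B p \<longleftrightarrow> H p \<noteq> 0"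
  proof
    assume "H p \<noteq> 0"
    have "isCont H p"
      using H S holomorphic_on_imp_continuous_on continuous_on_eq_continuous_at by blast
    moreover have "filterlim (\<lambda>t. c * (t - p)) (at 0) (at p)"
      unfolding filterlim_at using c
      by (auto intro!: tendsto_eq_intros simp: eventually_at_filter)
    ultimately have "is_pole (\<lambda>t. H t / (c * (t - p))) p"
      using \<open>H p \<noteq> 0\<close> by (intro is_pole_divide)
    thus "is_pole B p" using evB is_pole_transform by blast
  next
    assume pole: "is_pole B p"
    show "H p \<noteq> 0"
    proof
      assume "H p = 0"
      hence "\<forall>\<^sub>F t in at p. B t = g t" using ev by simp
      hence "is_pole g p" using pole is_pole_transform by blast
      thus False using not_is_pole_holomorphic S g by blast
    qed
  qed
  show "zorder B p = -1" if "H p \<noteq> 0"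
  proof (rule zorder_eqI[OF S])
    show "(\<lambda>t. H t / c) holomorphic_on S" using H c by (intro holomorphic_intros) auto
    show "B w = H w / c * (w - p) powi - 1" if "w \<in> S" "w \<noteq> p" for w
      using B[OF that] by (simp add: power_int_minus field_simps)
  qed (use that c in auto)
qed

section \<open>Heine's formula and the poles of the continuation\<close>

theorem mainTheorem1:
  fixes q a b :: complex
  assumes "0 < norm q" and "norm q < 1"
  shows
    "(\<forall>t. norm t < 1 \<longrightarrow>
        (\<lambda>n. qpoch a q n * qpoch b q n / qpoch q q n * (- t) ^ n) sums phi21 a b 0 q (- t) \<and>
        (\<lambda>n. fps_nth (q_borel q (phi20 a b q)) n * t ^ n) sums phi21 a b 0 q (- t)) \<and>
     (\<exists>B. continues_phi21 q a b B) \<and>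
     (\<exists>d :: int \<Rightarrow> complex.
        d (-1) = 0 \<and>
        d 0 = qpoch_inf a q * qpoch_inf b q / qpoch_inf q q \<and>
        (\<forall>j\<ge>1. (1 - q powi (- j)) * d j =
                 (1 - (a + b) * q powi (- j)) * d (j - 1) + a * b * q powi (- j) * d (j - 2)) \<and>
        (\<forall>B. continues_phi21 q a b B \<longrightarrow>
           (\<forall>t. t \<notin> q_lattice q \<and> (\<forall>k::nat. - b * t * q ^ k \<noteq> 1) \<longrightarrow>
              B t = qpoch_inf (- b * t) q / qpoch_inf (- t) q * phi11 b (- b * t) q (- a * t)) \<and>
           (\<forall>j\<ge>0. let p = - (q powi (- j)) in
              (\<exists>g. g analytic_on {p} \<and>
                   (\<forall>\<^sub>F t in at p. B t = d j / (1 + t * q powi j) + g t)) \<and>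
              (is_pole B p \<longleftrightarrow> d j \<noteq> 0) \<and>
              (d j \<noteq> 0 \<longrightarrow> zorder B p = -1))))"
proof -
  have q: "q \<noteq> 0" "norm q < 1" using assms by auto
  define d where "d j = (if j < 0 then 0 else heine_res q a b (nat j))" for j :: int
  show ?thesis
  proof (intro conjI allI impI exI[of _ d])
    fix t :: complex assume t: "norm t < 1"
    show "(\<lambda>n. qpoch a q n * qpoch b q n / qpoch q q n * (- t) ^ n) sums phi21 a b 0 q (- t)"
      using heine_cont_sums[OF q, of "- t" a b] phi21_eq_heine_cont[OF q, of "- t" a b] t by simp
    also have "(\<lambda>n. qpoch a q n * qpoch b q n / qpoch q q n * (- t) ^ n) =
                 (\<lambda>n. fps_nth (q_borel q (phi20 a b q)) n * t ^ n)"
      using q(1) by (auto simp: q_borel_def phi20_def power_int_minus fun_eq_iff power_minus[of t])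
    finally show "(\<lambda>n. fps_nth (q_borel q (phi20 a b q)) n * t ^ n) sums phi21 a b 0 q (- t)" .
  next
    show "\<exists>B. continues_phi21 q a b B"
      using continues_phi21_heine_cont[OF q] by blast
    show "d (-1) = 0" by (simp add: d_def)
    show "d 0 = qpoch_inf a q * qpoch_inf b q / qpoch_inf q q"
      by (simp add: d_def heine_res_def[OF q] heine_num_1[OF q])
  next
    fix j :: int assume "j \<ge> 1"
    define n where "n = nat (j - 1)"
    have n: "j = int (Suc n)" using \<open>j \<ge> 1\<close> by (simp add: n_def)
    have "q powi (- j) = inverse q ^ Suc n"
      unfolding n power_int_minus power_int_of_nat power_inverse ..
    moreover have "d j = heine_res q a b (Suc n)" "d (j - 1) = heine_res q a b n"
      "d (j - 2) = (if n = 0 then 0 else heine_res q a b (n - 1))"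
      by (auto simp: d_def n nat_diff_distrib intro!: arg_cong[of _ _ "heine_res q a b"])
    ultimately show "(1 - q powi (- j)) * d j =
        (1 - (a + b) * q powi (- j)) * d (j - 1) + a * b * q powi (- j) * d (j - 2)"
      using heine_res_Suc[OF q, of n a b] by (simp only:)
  next
    fix B t
    assume B: "continues_phi21 q a b B" 
      and t: "t \<notin> q_lattice q \<and> (\<forall>k::nat. - b * t * q ^ k \<noteq> 1)"
    have "B t = heine_cont q a b (- t)"
      using continues_phi21_unique[OF q B] t by blast
    thus "B t = qpoch_inf (- b * t) q / qpoch_inf (- t) q * phi11 b (- b * t) q (- a * t)"
      using heine_num_phi11[OF q, of b "- t" a] t by (simp add: heine_cont_def[OF q])
  next
    fix B and j :: int
    assume B: "continues_phi21 q a b B" and j: "j \<ge> 0"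
    define p where "p = - (q powi (- j))"
    obtain n where n: "j = int n" using j nonneg_int_cases by blast
    have p: "p = - (inverse q ^ n)"
      by (simp add: p_def n power_int_minus power_inverse)
    obtain S H where SH: "open S" "p \<in> S" "H holomorphic_on S" and Hp: "H p = heine_res q a b n"
      and loc: "\<And>t. t \<in> S \<Longrightarrow> t \<noteq> p \<Longrightarrow>
         t \<notin> q_lattice q \<and> heine_cont q a b (- t) = H t / (q ^ n * (t - p))"
      using heine_cont_local[OF q, of n a b] unfolding p by blast
    have "B t = H t / (q ^ n * (t - p))" if "t \<in> S" "t \<noteq> p" for t
      using loc[OF that] continues_phi21_unique[OF q B] by simp
    note pole = simple_pole_quotient[OF SH _ this]
    have "d j = H p" by (simp add: d_def n Hp)
    moreover have "q ^ n * (t - p) = 1 + t * q powi j" for t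
      using q(1) by (simp add: p n field_simps)
    ultimately show "let p = - (q powi (- j)) in
          (\<exists>g. g analytic_on {p} \<and> (\<forall>\<^sub>F t in at p. B t = d j / (1 + t * q powi j) + g t)) \<and>
          (is_pole B p \<longleftrightarrow> d j \<noteq> 0) \<and> (d j \<noteq> 0 \<longrightarrow> zorder B p = -1)"
      using pole q(1) unfolding Let_def p_def[symmetric] by simp
  qed
qed

end
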